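(* Let $\theta:\mathbb{R}^n\to(-\infty,\infty]$ be a closed proper convex function and let $F:\mathbb{R}^n\to\mathbb{R}^n$ be monotone and Lipschitz continuous. Let $x^*$ be any solution of $\mathrm{MGVI}(\theta,F)$, and for any $x\in\mathbb{R}^n$ and $\beta>0$ let $\tilde x=\mathrm{Prox}_{\beta\theta}(x-\beta F(x))$. Then the following three inequalities hold: $$\beta\theta(\tilde x)-\beta\theta(x^* )+(\tilde x-x^* )^T\beta F(x^* )\ge 0,$$ $$\beta\theta(x^* )-\beta\theta(\tilde x)+(\tilde x-x^* )^T\big([x-\beta F(x)]-\tilde x\big)\ge 0,$$ $$(\tilde x-x^* )^T\big(\beta F(\tilde x)-\beta F(x^* )\big)\ge 0.$$
   Context: $\mathbb{R}^n$ carries the standard inner product and Euclidean norm $\|\cdot\|$. A function is closed proper convex if its epigraph is closed and convex and its effective domain $\{x:\theta(x)<\infty\}$ is nonempty. $F$ is monotone if $(F(x)-F(y))^T(x-y)\ge 0$ for all $x,y\in\mathbb{R}^n$. A solution of $\mathrm{MGVI}(\theta,F)$ is a point $x^*\in\mathbb{R}^n$ with $\theta(x)-\theta(x^* )+(x-x^* )^TF(x^* )\ge 0$ for all $x\in\mathbb{R}^n$ (with the convention $\infty-\infty=\infty$). For a closed proper convex $f$, $\mathrm{Prox}_f(x)$ is the unique minimizer over $y\in\mathbb{R}^n$ of $f(y)+\frac12\|x-y\|^2$. *)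

theory Defs
  imports "HOL-Analysis.Analysis"
begin

text \<open>
  The library's \<^const>\<open>epigraph\<close> is restricted to real-valued functions; here the function is
  extended-real-valued, while the second coordinate of an epigraph point stays real.
\<close>

definition ereal_epigraph :: "('a \<Rightarrow> ereal) \<Rightarrow> ('a \<times> real) set" where
  "ereal_epigraph f = {(x, r). f x \<le> ereal r}"

definition effective_domain :: "('a \<Rightarrow> ereal) \<Rightarrow> 'a set" where
  "effective_domain f = {x. f x < \<infinity>}"

text \<open>
  The value \<open>-\<infinity>\<close> is not excluded by this predicate: that functions take values in
  \<open>(-\<infinity>, \<infinity>]\<close> has to be assumed separately.
\<close>

definition closed_proper_convex :: "('a::real_normed_vector \<Rightarrow> ereal) \<Rightarrow> bool" where
  "closed_proper_convex f \<longleftrightarrow>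
     closed (ereal_epigraph f) \<and> convex (ereal_epigraph f) \<and> effective_domain f \<noteq> {}"

definition monotone_operator :: "('a::real_inner \<Rightarrow> 'a) \<Rightarrow> bool" where
  "monotone_operator F \<longleftrightarrow> (\<forall>x y. (F x - F y) \<bullet> (x - y) \<ge> 0)"

text \<open>
  Subtraction on \<^typ>\<open>ereal\<close> satisfies \<open>\<infinity> - \<infinity> = \<infinity>\<close>, which is the convention wanted here.
\<close>

definition MGVI_solution :: "('a::real_inner \<Rightarrow> ereal) \<Rightarrow> ('a \<Rightarrow> 'a) \<Rightarrow> 'a \<Rightarrow> bool" where
  "MGVI_solution \<theta> F xs \<longleftrightarrow> (\<forall>x. \<theta> x - \<theta> xs + ereal ((x - xs) \<bullet> F xs) \<ge> 0)"

definition Prox :: "('a::real_inner \<Rightarrow> ereal) \<Rightarrow> 'a \<Rightarrow> 'a" where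
  "Prox f x = (THE y. is_arg_min (\<lambda>y. f y + ereal (1 / 2 * (norm (x - y))\<^sup>2)) (\<lambda>_. True) y)"

end

theory Submission
  imports Defs
begin

text \<open>
  The first inequality is the variational inequality that \<open>xs\<close> solves, tested at \<open>xt\<close> and scaled by
  \<open>\<beta>\<close>; the third is monotonicity of \<open>F\<close>. The second is the optimality condition of the proximal
  point: if \<open>p\<close> minimizes \<open>f y + (norm (z - y))\<^sup>2 / 2\<close>, then \<open>z - p\<close> is a subgradient of \<open>f\<close> at \<open>p\<close>
  (\<open>proximal_minimizer_subgradient\<close>), and this is applied to \<open>f = \<beta>\<theta>\<close>, \<open>z = x - \<beta> F x\<close>, at the
  point \<open>xs\<close>.

  \<^const>\<open>Prox\<close> is a definite description, so the condition says something about it only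
  once the minimizer is known to exist and to be unique. Uniqueness follows from the subgradient
  inequality itself, since \<open>y \<mapsto> z - y\<close> is strongly antitone whereas subgradients are monotone. For
  existence the quadratic term must dominate \<open>f\<close> at infinity, which it does as soon as \<open>f\<close> has an
  affine minorant. The variational inequality provides one for \<open>\<theta>\<close>, hence for \<open>\<beta>\<theta>\<close>:
  \<open>\<theta> y \<ge> \<theta> xs - (y - xs) \<bullet> F xs\<close> for every \<open>y\<close>.
\<close>

section \<open>Minimizers of the proximal objective\<close>

text \<open>
  Minimality is compared along the segment from \<open>p\<close> to \<open>y\<close>: moving a fraction \<open>t\<close> of the way
  changes \<open>f\<close> by at most \<open>t * (b - a)\<close> by convexity and the quadratic term by
  \<open>- t * ((z - p) \<bullet> (y - p))\<close> up to order \<open>t\<^sup>2\<close>. Dividing by \<open>t\<close> and letting \<open>t\<close> tend to 0 leaves the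
  subgradient inequality. Finite function values enter as the reals \<open>a\<close> and \<open>b\<close>, so that
  the computation takes place in the real numbers.
\<close>

lemma proximal_minimizer_subgradient:
  fixes f :: "'a::real_inner \<Rightarrow> ereal"
  assumes conv: "convex (ereal_epigraph f)"
    and fp: "f p = ereal a" and fy: "f y \<le> ereal b"
    and min: "\<And>w. f p + ereal (1 / 2 * (norm (z - p))\<^sup>2) \<le> f w + ereal (1 / 2 * (norm (z - w))\<^sup>2)"
  shows "a + (z - p) \<bullet> (y - p) \<le> b"
proof -
  define D where "D = (norm (y - p))\<^sup>2 / 2"
  define s where "s = (z - p) \<bullet> (y - p)"
  have step: "a + s - b \<le> t * D" if t: "0 < t" "t < 1" for t
  proof -
    define w where "w = (1 - t) *\<^sub>R p + t *\<^sub>R y"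
    have "(1 - t) *\<^sub>R (p, a) + t *\<^sub>R (y, b) \<in> ereal_epigraph f"
      using conv t fp fy by (intro convexD_alt) (auto simp: ereal_epigraph_def)
    then have fw: "f w \<le> ereal ((1 - t) * a + t * b)"
      by (simp add: ereal_epigraph_def w_def)
    have "ereal (a + 1 / 2 * (norm (z - p))\<^sup>2) \<le> f w + ereal (1 / 2 * (norm (z - w))\<^sup>2)"
      using min[of w] fp by simp
    also have "\<dots> \<le> ereal ((1 - t) * a + t * b) + ereal (1 / 2 * (norm (z - w))\<^sup>2)"
      using fw by (rule add_right_mono)
    finally have le: "a + 1 / 2 * (norm (z - p))\<^sup>2
        \<le> (1 - t) * a + t * b + 1 / 2 * (norm (z - w))\<^sup>2"
      by simp
    have zw: "z - w = (z - p) - t *\<^sub>R (y - p)"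
      by (simp add: w_def algebra_simps)
    have expand: "(norm (u - t *\<^sub>R v))\<^sup>2 = (norm u)\<^sup>2 - 2 * t * (u \<bullet> v) + t\<^sup>2 * (norm v)\<^sup>2"
      for u v :: 'a
      unfolding power2_norm_eq_inner
      by (simp add: inner_diff_left inner_diff_right inner_commute power2_eq_square)
    have "(norm (z - w))\<^sup>2 = (norm (z - p))\<^sup>2 - 2 * t * s + t\<^sup>2 * (2 * D)"
      unfolding zw expand by (simp add: D_def s_def)
    with le have "t * (a + s - b) \<le> t * (t * D)"
      by (simp add: algebra_simps power2_eq_square)
    with t show ?thesis by simp
  qed
  have "((\<lambda>t. t * D) \<longlongrightarrow> 0 * D) (at_right (0::real))"
    by (intro tendsto_intros)
  moreover have "eventually (\<lambda>t. a + s - b \<le> t * D) (at_right (0::real))"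
    using step by (auto simp: eventually_at_right[OF zero_less_one] intro!: exI[of _ 1])
  ultimately have "a + s - b \<le> 0 * D"
    by (intro tendsto_lowerbound) auto
  then show ?thesis by (simp add: s_def)
qed

text \<open>
  The minimization takes place on the epigraph, where the objective becomes the continuous real
  function \<open>r + (norm (z - y))\<^sup>2 / 2\<close> of \<open>(y, r)\<close>; closedness of the epigraph then replaces lower
  semicontinuity of \<open>f\<close>. Completing the square in the affine minorant plus the quadratic term
  confines a sublevel set of the objective to a bounded region.
\<close>

lemma proximal_minimizer_exists:
  fixes f :: "'a::euclidean_space \<Rightarrow> ereal"
  assumes clo: "closed (ereal_epigraph f)"
    and dom: "effective_domain f \<noteq> {}"
    and minorant: "\<And>y. ereal (m + y \<bullet> v) \<le> f y"
  shows "\<exists>p. \<forall>w. f p + ereal (1 / 2 * (norm (z - p))\<^sup>2) \<le> f w + ereal (1 / 2 * (norm (z - w))\<^sup>2)"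
proof -
  have finite_value: "\<exists>r. f y = ereal r" if "f y < \<infinity>" for y
    using that minorant[of y] by (cases "f y") auto
  obtain y0 r0 where r0: "f y0 = ereal r0"
    using dom finite_value unfolding effective_domain_def by blast
  define h where "h = (\<lambda>q::'a \<times> real. snd q + 1 / 2 * (norm (z - fst q))\<^sup>2)"
  define c where "c = h (y0, r0)"
  \<comment> \<open>On the sublevel set of level \<open>c\<close>, \<open>2 * K\<close> bounds the square that is completed around \<open>z - v\<close>.\<close>
  define K where "K = c - m - z \<bullet> v + (norm v)\<^sup>2 / 2"
  define R where "R = sqrt (2 * K)"
  define B where "B = cball (z - v) R \<times> {m + (z - v) \<bullet> v - R * norm v .. c}"
  have hcont: "continuous_on UNIV h"
    unfolding h_def by (intro continuous_intros)
  define S where "S = B \<inter> ereal_epigraph f"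
  have "compact S"
    unfolding S_def B_def using clo by (intro compact_Int_closed compact_Times) auto
  have sub: "q \<in> S" if q: "q \<in> ereal_epigraph f" and hq: "h q \<le> c" for q
  proof -
    obtain y r where yr: "q = (y, r)" by (cases q)
    have fy: "f y \<le> ereal r" using q yr by (simp add: ereal_epigraph_def)
    have lower: "m + y \<bullet> v \<le> r"
      using order_trans[OF minorant fy] by simp
    have hle: "r + 1 / 2 * (norm (z - y))\<^sup>2 \<le> c" using hq yr by (simp add: h_def)
    have square: "(norm (z - v - y))\<^sup>2 = (norm (z - y))\<^sup>2 + 2 * (y \<bullet> v) - 2 * (z \<bullet> v) + (norm v)\<^sup>2"
      by (simp add: power2_norm_eq_inner inner_diff_left inner_diff_right inner_commute)
    have "(norm (z - v - y))\<^sup>2 \<le> 2 * K"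
      unfolding K_def square using lower hle by simp
    then have ball: "norm (z - v - y) \<le> R"
      unfolding R_def by (rule real_le_rsqrt)
    have "(z - v - y) \<bullet> v \<le> norm (z - v - y) * norm v"
      by (rule norm_cauchy_schwarz)
    also have "\<dots> \<le> R * norm v"
      using ball by (rule mult_right_mono) simp
    finally have "(z - v) \<bullet> v - y \<bullet> v \<le> R * norm v"
      by (simp add: inner_diff_left)
    moreover have "r \<le> c"
      using hle zero_le_power2[of "norm (z - y)"] by linarith
    ultimately show ?thesis
      using ball lower q yr by (auto simp: S_def B_def dist_norm)
  qed
  have "(y0, r0) \<in> S"
    using r0 by (intro sub) (auto simp: ereal_epigraph_def c_def)
  then obtain q where qS: "q \<in> S" and qmin: "\<And>u. u \<in> S \<Longrightarrow> h q \<le> h u"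
    using continuous_attains_inf[OF \<open>compact S\<close> _ continuous_on_subset[OF hcont]] by blast
  have "f (fst q) + ereal (1 / 2 * (norm (z - fst q))\<^sup>2) \<le> f w + ereal (1 / 2 * (norm (z - w))\<^sup>2)"
    for w
  proof (cases "f w < \<infinity>")
    case True
    then obtain r where r: "f w = ereal r" using finite_value by blast
    have "h q \<le> h (w, r)"
    proof (cases "h (w, r) \<le> c")
      case True
      then show ?thesis using r by (intro qmin sub) (auto simp: ereal_epigraph_def)
    next
      case False
      then show ?thesis using qmin[OF \<open>(y0, r0) \<in> S\<close>] by (simp add: c_def)
    qed
    have "f (fst q) \<le> ereal (snd q)"
      using qS by (auto simp: S_def ereal_epigraph_def)
    then have "f (fst q) + ereal (1 / 2 * (norm (z - fst q))\<^sup>2)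
        \<le> ereal (snd q) + ereal (1 / 2 * (norm (z - fst q))\<^sup>2)"
      by (rule add_right_mono)
    also have "\<dots> = ereal (h q)"
      by (simp add: h_def)
    also have "\<dots> \<le> ereal (h (w, r))"
      using \<open>h q \<le> h (w, r)\<close> by simp
    also have "\<dots> = f w + ereal (1 / 2 * (norm (z - w))\<^sup>2)"
      using r by (simp add: h_def)
    finally show ?thesis .
  next
    case False
    then show ?thesis by simp
  qed
  then show ?thesis by blast
qed

section \<open>The proximal point\<close>

text \<open>
  Two minimizers \<open>p\<close> and \<open>q\<close> each satisfy the subgradient inequality tested at the other; the sum
  of the two inequalities reads \<open>(norm (p - q))\<^sup>2 \<le> 0\<close>. Hence the definite description denotes the
  minimizer and inherits its subgradient inequality.
\<close>

lemma Prox_subgradient: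
  fixes f :: "'a::euclidean_space \<Rightarrow> ereal"
  assumes cpc: "closed_proper_convex f"
    and minorant: "\<And>y. ereal (m + y \<bullet> v) \<le> f y"
  obtains a where "f (Prox f z) = ereal a"
    and "\<And>y b. f y \<le> ereal b \<Longrightarrow> a + (z - Prox f z) \<bullet> (y - Prox f z) \<le> b"
proof -
  let ?obj = "\<lambda>y. f y + ereal (1 / 2 * (norm (z - y))\<^sup>2)"
  have clo: "closed (ereal_epigraph f)" and conv: "convex (ereal_epigraph f)"
    and dom: "effective_domain f \<noteq> {}"
    using cpc by (auto simp: closed_proper_convex_def)
  have finite_value: "\<exists>a. f p = ereal a" if p: "\<And>w. ?obj p \<le> ?obj w" for p
  proof -
    obtain y0 where "f y0 < \<infinity>" using dom by (auto simp: effective_domain_def)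
    then have "f p \<noteq> \<infinity>" using p[of y0] by auto
    then show ?thesis using minorant[of p] by (cases "f p") auto
  qed
  obtain p where p: "\<And>w. ?obj p \<le> ?obj w"
    using proximal_minimizer_exists[OF clo dom minorant, of z] by blast
  obtain a where a: "f p = ereal a" using finite_value[OF p] by blast
  note sub_p = proximal_minimizer_subgradient[OF conv a _ p]
  have unique: "q = p" if q: "\<And>w. ?obj q \<le> ?obj w" for q
  proof -
    obtain b where b: "f q = ereal b" using finite_value[OF q] by blast
    have "a + (z - p) \<bullet> (q - p) \<le> b" using b by (intro sub_p) simp
    moreover have "b + (z - q) \<bullet> (p - q) \<le> a"
      using a by (intro proximal_minimizer_subgradient[OF conv b _ q]) simp
    ultimately have "(z - p) \<bullet> (q - p) + (z - q) \<bullet> (p - q) \<le> 0" by simp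
    then have "(q - p) \<bullet> (q - p) \<le> 0"
      by (simp add: inner_diff_left inner_diff_right inner_commute)
    then have "q - p = 0"
      using inner_gt_zero_iff[of "q - p"] by (meson not_less)
    then show ?thesis by simp
  qed
  have "Prox f z = p"
    unfolding Prox_def is_arg_min_def using p unique
    by (intro the_equality) (simp_all add: not_less)
  with a sub_p that show thesis by blast
qed

lemma closed_proper_convex_scale:
  fixes f :: "'a::real_normed_vector \<Rightarrow> ereal"
  assumes "closed_proper_convex f" and \<beta>: "\<beta> > 0"
  shows "closed_proper_convex (\<lambda>y. ereal \<beta> * f y)"
proof -
  have scale_le: "ereal \<beta> * f y \<le> ereal r \<longleftrightarrow> f y \<le> ereal (r / \<beta>)" for y r
    using \<beta> by (cases "f y") (auto simp: field_simps)
  have epigraph_scale: "ereal_epigraph (\<lambda>y. ereal \<beta> * f y)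
      = (\<lambda>q. (fst q, snd q / \<beta>)) -` ereal_epigraph f"
    by (auto simp: ereal_epigraph_def scale_le)
  have "closed (ereal_epigraph (\<lambda>y. ereal \<beta> * f y))"
    unfolding epigraph_scale using assms
    by (intro closed_vimage continuous_intros) (auto simp: closed_proper_convex_def)
  moreover have "linear (\<lambda>q::'a \<times> real. (fst q, snd q / \<beta>))"
    by (intro linearI) (auto simp: add_divide_distrib)
  then have "convex (ereal_epigraph (\<lambda>y. ereal \<beta> * f y))"
    unfolding epigraph_scale using assms
    by (intro convex_linear_vimage) (auto simp: closed_proper_convex_def)
  moreover have "effective_domain f \<subseteq> effective_domain (\<lambda>y. ereal \<beta> * f y)"
  proof
    fix y assume "y \<in> effective_domain f"
    then show "y \<in> effective_domain (\<lambda>y. ereal \<beta> * f y)"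
      using \<beta> by (cases "f y") (auto simp: effective_domain_def)
  qed
  ultimately show ?thesis
    using assms(1) by (auto simp: closed_proper_convex_def)
qed

section \<open>The three inequalities\<close>

text \<open>
  With \<open>\<theta> xs = \<infinity>\<close> the variational inequality would fail at every point of the effective domain, because
  \<open>r - \<infinity> = - \<infinity>\<close> for real \<open>r\<close>. So \<open>\<theta> xs\<close> is a real number, and the variational
  inequality turns into an affine minorant of \<open>\<theta>\<close> that is exact at \<open>xs\<close>.
\<close>

lemma MGVI_solution_minorant:
  fixes \<theta> :: "'a::real_inner \<Rightarrow> ereal"
  assumes ninf: "\<And>y. \<theta> y \<noteq> -\<infinity>" and dom: "effective_domain \<theta> \<noteq> {}"
    and sol: "MGVI_solution \<theta> F xs"
  obtains c where "\<theta> xs = ereal c" and "\<And>y. ereal (c - (y - xs) \<bullet> F xs) \<le> \<theta> y"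
proof -
  have vi: "\<theta> y - \<theta> xs + ereal ((y - xs) \<bullet> F xs) \<ge> 0" for y
    using sol by (simp add: MGVI_solution_def)
  obtain y0 where "\<theta> y0 < \<infinity>" using dom by (auto simp: effective_domain_def)
  then have "\<theta> xs \<noteq> \<infinity>" using vi[of y0] ninf[of y0] by (cases "\<theta> y0") auto
  then obtain c where c: "\<theta> xs = ereal c" using ninf[of xs] by (cases "\<theta> xs") auto
  have "ereal (c - (y - xs) \<bullet> F xs) \<le> \<theta> y" for y
    using vi[of y] ninf[of y] c by (cases "\<theta> y") (auto simp: zero_ereal_def)
  with c that show thesis by blast
qed

theorem proposition4p1:
  fixes \<theta> :: "real ^ 'n \<Rightarrow> ereal"
    and F :: "real ^ 'n \<Rightarrow> real ^ 'n"
    and xs x xt :: "real ^ 'n"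
    and \<beta> :: real
  assumes "\<forall>y. \<theta> y \<noteq> -\<infinity>"
    and "closed_proper_convex \<theta>"
    and "monotone_operator F"
    and "\<exists>L. L-lipschitz_on UNIV F"
    and "MGVI_solution \<theta> F xs"
    and "\<beta> > 0"
    and "xt = Prox (\<lambda>y. ereal \<beta> * \<theta> y) (x - \<beta> *\<^sub>R F x)"
  shows "ereal \<beta> * \<theta> xt - ereal \<beta> * \<theta> xs + ereal ((xt - xs) \<bullet> (\<beta> *\<^sub>R F xs)) \<ge> 0 \<and>
         ereal \<beta> * \<theta> xs - ereal \<beta> * \<theta> xt + ereal ((xt - xs) \<bullet> ((x - \<beta> *\<^sub>R F x) - xt)) \<ge> 0 \<and>
         (xt - xs) \<bullet> (\<beta> *\<^sub>R F xt - \<beta> *\<^sub>R F xs) \<ge> 0"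
proof -
  let ?f = "\<lambda>y. ereal \<beta> * \<theta> y" and ?z = "x - \<beta> *\<^sub>R F x"
  have \<beta>: "\<beta> > 0" by fact
  obtain c where c: "\<theta> xs = ereal c"
    and minorant: "\<And>y. ereal (c - (y - xs) \<bullet> F xs) \<le> \<theta> y"
    using MGVI_solution_minorant[of \<theta> F xs] assms(1,2,5)
    by (auto simp: closed_proper_convex_def)
  have "ereal (\<beta> * (c + xs \<bullet> F xs) + y \<bullet> (- \<beta> *\<^sub>R F xs)) \<le> ?f y" for y
  proof -
    have "ereal (\<beta> * (c + xs \<bullet> F xs) + y \<bullet> (- \<beta> *\<^sub>R F xs))
        = ereal \<beta> * ereal (c - (y - xs) \<bullet> F xs)"
      by (simp add: inner_diff_left algebra_simps)
    also have "\<dots> \<le> ?f y"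
      using \<beta> by (intro ereal_mult_left_mono minorant) simp
    finally show ?thesis .
  qed
  then obtain a where a: "?f xt = ereal a"
    and subgradient: "\<And>y b. ?f y \<le> ereal b \<Longrightarrow> a + (?z - xt) \<bullet> (y - xt) \<le> b"
    using Prox_subgradient[OF closed_proper_convex_scale[OF assms(2) \<beta>], of _ _ ?z] assms(7)
    by metis
  obtain d where d: "\<theta> xt = ereal d" and ad: "a = \<beta> * d"
    using a \<beta> by (cases "\<theta> xt") auto
  have "c - (xt - xs) \<bullet> F xs \<le> d"
    using minorant[of xt] d by simp
  then have "0 \<le> \<beta> * (d - c + (xt - xs) \<bullet> F xs)"
    using \<beta> by simp
  then have first: "0 \<le> \<beta> * d - \<beta> * c + (xt - xs) \<bullet> (\<beta> *\<^sub>R F xs)"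
    by (simp add: algebra_simps)
  have "\<beta> * d + (?z - xt) \<bullet> (xs - xt) \<le> \<beta> * c"
    using subgradient[of xs "\<beta> * c"] c ad by simp
  moreover have "(xt - xs) \<bullet> (?z - xt) = - ((?z - xt) \<bullet> (xs - xt))"
    by (metis inner_commute inner_minus_right minus_diff_eq)
  ultimately have second: "0 \<le> \<beta> * c - \<beta> * d + (xt - xs) \<bullet> (?z - xt)"
    by linarith
  have "0 \<le> \<beta> * ((F xt - F xs) \<bullet> (xt - xs))"
    using assms(3) \<beta> by (simp add: monotone_operator_def)
  also have "\<dots> = (xt - xs) \<bullet> (\<beta> *\<^sub>R F xt - \<beta> *\<^sub>R F xs)"
    by (simp add: inner_commute flip: scaleR_diff_right)
  finally have third: "0 \<le> (xt - xs) \<bullet> (\<beta> *\<^sub>R F xt - \<beta> *\<^sub>R F xs)" .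
  show ?thesis
    using first second third c d by simp
qed

end
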